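(* Let $G$ be a nontrivial finite group and let $S$ be a self-normalizing subgroup of $G$. Then either $\mathrm{ncl}_{G}(S) = G$ or $\mathrm{ncl}_{G}(S)$ is a proper essential subgroup of $G$.
   Context: A subgroup $S$ of $G$ is self-normalizing if $\mathrm{N}_{G}(S) = S$. $\mathrm{ncl}_{G}(S)$ denotes the normal closure of $S$ in $G$, i.e. the smallest normal subgroup of $G$ containing $S$. A normal subgroup $E$ of a group $G$ is called an essential subgroup of $G$ if every nontrivial normal subgroup of $G$ intersects $E$ nontrivially; it is a proper essential subgroup if moreover $E \neq G$. *)

theory Defs
  imports "HOL-Algebra.Algebra"
begin

definition self_normalizing :: "('a, 'b) monoid_scheme \<Rightarrow> 'a set \<Rightarrow> bool" where
  "self_normalizing G S \<longleftrightarrow> subgroup S G \<and> normalizer G S = S"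

definition normal_closure :: "('a, 'b) monoid_scheme \<Rightarrow> 'a set \<Rightarrow> 'a set" where
  "normal_closure G S = \<Inter> {N. N \<lhd> G \<and> S \<subseteq> N}"

definition essential_subgroup :: "('a, 'b) monoid_scheme \<Rightarrow> 'a set \<Rightarrow> bool" where
  "essential_subgroup G E \<longleftrightarrow>
     E \<lhd> G \<and> (\<forall>N. N \<lhd> G \<and> N \<noteq> {\<one>\<^bsub>G\<^esub>} \<longrightarrow> N \<inter> E \<noteq> {\<one>\<^bsub>G\<^esub>})"

definition proper_essential_subgroup :: "('a, 'b) monoid_scheme \<Rightarrow> 'a set \<Rightarrow> bool" where
  "proper_essential_subgroup G E \<longleftrightarrow> essential_subgroup G E \<and> E \<noteq> carrier G"

text \<open>The intersection is the smallest normal subgroup containing \<open>S\<close>.\<close>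

lemma (in group) normal_closure_least:
  assumes "S \<subseteq> carrier G"
  shows "normal_closure G S \<lhd> G"
    and "S \<subseteq> normal_closure G S"
    and "N \<lhd> G \<Longrightarrow> S \<subseteq> N \<Longrightarrow> normal_closure G S \<subseteq> N"
proof -
  let ?F = "{N. N \<lhd> G \<and> S \<subseteq> N}"
  have "carrier G \<lhd> G"
    by (auto simp: normal_inv_iff subgroup_self)
  with assms have ne: "?F \<noteq> {}" by blast
  have "subgroup (\<Inter> ?F) G"
    by (rule subgroups_Inter[OF _ ne]) (auto simp: normal_inv_iff)
  then show "normal_closure G S \<lhd> G"
    unfolding normal_closure_def by (auto simp: normal_inv_iff)
qed (auto simp: normal_closure_def)

end

theory Submission
  imports Defs
begin

text \<open>
  If a normal subgroup \<open>N\<close> meets \<open>ncl(S)\<close> trivially, the two commute elementwise, so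
  \<open>N\<close> centralizes \<open>S\<close>. Then \<open>N\<close> normalizes \<open>S\<close>, hence lies in \<open>S\<close> and so in \<open>ncl(S)\<close>,
  which forces \<open>N\<close> to be trivial.
\<close>

text \<open>Conjugation by \<open>x\<close> fixes \<open>H\<close> pointwise, hence as a
  set.\<close>

lemma (in group) commuting_in_normalizer:
  assumes "H \<subseteq> carrier G" "x \<in> carrier G" "\<And>h. h \<in> H \<Longrightarrow> x \<otimes> h = h \<otimes> x"
  shows "x \<in> normalizer G H"
proof -
  have "x \<otimes> h \<otimes> inv x = h" if "h \<in> H" for h
    using that assms by (metis inv_solve_right' m_closed subsetD)
  then have "x <# H #> inv x = H"
    by (auto simp: l_coset_def r_coset_def)
  \<comment> \<open>\<open>normalizer\<close> is a stabilizer under conjugation restricted to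
    subsets of the carrier, hence the use of \<open>assms(1)\<close>.\<close>
  with assms(1,2) show ?thesis
    by (simp add: normalizer_def stabilizer_def)
qed

lemma (in group) normal_subgroup_trivial_if_disjoint_normal_closure:
  assumes "self_normalizing G S" "N \<lhd> G" "N \<inter> normal_closure G S = {\<one>}"
  shows "N = {\<one>}"
proof -
  have S: "S \<subseteq> carrier G" and norm: "normalizer G S = S"
    using assms(1) by (auto simp: self_normalizing_def subgroup.subset)
  note ncl = normal_closure_least(1,2)[OF S]
  have "N \<subseteq> normalizer G S"
  proof
    fix x assume x: "x \<in> N"
    with assms(2) have "x \<in> carrier G"
      by (meson normal_imp_subgroup subgroup.mem_carrier)
    \<comment> \<open>A commutator of elements of two normal subgroups lies in both, so it is
      trivial here.\<close>
    then show "x \<in> normalizer G S"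
      using commuting_in_normalizer[OF S]
        normal_imp_commuting[OF assms(2) ncl(1) equalityD1[OF assms(3)] x] ncl(2) by blast
  qed
  with norm ncl(2) assms(3) show ?thesis by blast
qed

theorem corollary2p5:
  fixes G :: "('a, 'b) monoid_scheme" and S :: "'a set"
  assumes "group G" and "finite (carrier G)" and "carrier G \<noteq> {\<one>\<^bsub>G\<^esub>}"
    and "self_normalizing G S"
  shows "normal_closure G S = carrier G \<or> proper_essential_subgroup G (normal_closure G S)"
proof -
  interpret group G by fact
  have "S \<subseteq> carrier G"
    using assms(4) by (simp add: self_normalizing_def subgroup.subset)
  \<comment> \<open>The intersection condition is the contrapositive of the preceding lemma.\<close>
  then have "essential_subgroup G (normal_closure G S)"
    using normal_closure_least(1) normal_subgroup_trivial_if_disjoint_normal_closure[OF assms(4)]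
    by (auto simp: essential_subgroup_def)
  then show ?thesis
    by (auto simp: proper_essential_subgroup_def)
qed

end
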